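(* Let $A=(a_{ij}),B=(b_{ij})\in\mathbb{R}^{n\times n}$ and $b\in\mathbb{R}^n$. Write $A=D_A-L_A-U_A$ and $B=D_B-L_B-U_B$, where $D_A,-L_A,-U_A$ (respectively $D_B,-L_B,-U_B$) are the diagonal, strictly lower triangular and strictly upper triangular parts of $A$ (respectively $B$). If $a_{ii}>|b_{ii}|$ for all $i=1,\ldots,n$ and the matrix $\langle A\rangle-|B|$ is an $M$-matrix, then the equation $Ax-B|x|=b$ has a unique solution $x_*\in\mathbb{R}^n$, and for any initial vector $x^{(0)}\in\mathbb{R}^n$ the sequence $\{x^{(k)}\}_{k=0}^\infty$ generated by $$(D_A-L_A)x^{(k+1)}-(D_B-L_B)|x^{(k+1)}|=U_Ax^{(k)}-U_B|x^{(k)}|+b,\quad k=0,1,2,\ldots,$$ converges to $x_*$.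
   Context: For a vector or matrix, $|\cdot|$ denotes the componentwise absolute value. The comparison matrix $\langle A\rangle=(\langle a_{ij}\rangle)$ of $A=(a_{ij})\in\mathbb{R}^{n\times n}$ is defined by $\langle a_{ii}\rangle=|a_{ii}|$ and $\langle a_{ij}\rangle=-|a_{ij}|$ for $i\ne j$. A matrix $C=(c_{ij})\in\mathbb{R}^{n\times n}$ is a $Z$-matrix if $c_{ij}\le 0$ for all $i\neq j$; it is an $M$-matrix if it is a $Z$-matrix, is nonsingular, and $C^{-1}\ge 0$ entrywise. Given $x^{(k)}$, the next iterate $x^{(k+1)}$ is the solution of the displayed lower triangular generalized absolute value system; since $a_{ii}>|b_{ii}|$ for all $i$, this solution exists and is unique (solve row by row, each row being a scalar equation of the form $\alpha t-\beta|t|=c$ with $\alpha>|\beta|$), so the iteration is well defined. *)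

theory Defs
  imports "HOL-Analysis.Analysis"
begin

text \<open>
  Indices range over a finite linearly ordered type, which plays the role of $1 < \dots < n$;
  "strictly lower/upper triangular" refers to this order.  On vectors and matrices, the library's
  \<open>\<bar>_\<bar>\<close> and \<open>\<le>\<close> are both componentwise.
\<close>

definition diag_part :: "real^'n^'n \<Rightarrow> real^'n^'n" where
  "diag_part A = (\<chi> i j. if i = j then A $ i $ j else 0)"

text \<open>
  The signs of the next two definitions are such that
  \<open>A = diag_part A - neg_strict_lower A - neg_strict_upper A\<close>.
\<close>

definition neg_strict_lower ::
  "real^'n::{finite,linorder}^'n::{finite,linorder}
    \<Rightarrow> real^'n::{finite,linorder}^'n::{finite,linorder}" where
  "neg_strict_lower A = (\<chi> i j. if j < i then - (A $ i $ j) else 0)"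

definition neg_strict_upper ::
  "real^'n::{finite,linorder}^'n::{finite,linorder}
    \<Rightarrow> real^'n::{finite,linorder}^'n::{finite,linorder}" where
  "neg_strict_upper A = (\<chi> i j. if i < j then - (A $ i $ j) else 0)"

lemma splitting: "A = diag_part A - neg_strict_lower A - neg_strict_upper A"
  by (auto simp: vec_eq_iff diag_part_def neg_strict_lower_def neg_strict_upper_def)

definition comparison_matrix :: "real^'n^'n \<Rightarrow> real^'n^'n" where
  "comparison_matrix A = (\<chi> i j. if i = j then \<bar>A $ i $ j\<bar> else - \<bar>A $ i $ j\<bar>)"

definition Z_matrix :: "real^'n^'n \<Rightarrow> bool" where
  "Z_matrix C \<longleftrightarrow> (\<forall>i j. i \<noteq> j \<longrightarrow> C $ i $ j \<le> 0)"

definition M_matrix :: "real^'n^'n \<Rightarrow> bool" where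
  "M_matrix C \<longleftrightarrow> Z_matrix C \<and> invertible C \<and> 0 \<le> matrix_inv C"

definition gave_solution :: "real^'n^'n \<Rightarrow> real^'n^'n \<Rightarrow> real^'n \<Rightarrow> real^'n \<Rightarrow> bool" where
  "gave_solution A B b x \<longleftrightarrow> A *v x - B *v \<bar>x\<bar> = b"

definition gave_iteration ::
  "real^'n::{finite,linorder}^'n::{finite,linorder}
    \<Rightarrow> real^'n::{finite,linorder}^'n::{finite,linorder}
    \<Rightarrow> real^'n::{finite,linorder}
    \<Rightarrow> (nat \<Rightarrow> real^'n::{finite,linorder})
    \<Rightarrow> bool" where
  "gave_iteration A B b x \<longleftrightarrow>
    (\<forall>k. (diag_part A - neg_strict_lower A) *v x (Suc k)
           - (diag_part B - neg_strict_lower B) *v \<bar>x (Suc k)\<bar>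
         = neg_strict_upper A *v x k - neg_strict_upper B *v \<bar>x k\<bar> + b)"

end

theory Submission
  imports Defs
begin

text \<open>
  Let $v$ be the solution of $(\langle A\rangle - |B|) v = e$ with $e$ the all-ones vector.  The
  $M$-matrix property gives $v > 0$, so $d(x,y) = \max_i |x_i - y_i| / v_i$ is a metric.  Solving
  every row for its diagonal unknown turns both problems into fixed point equations of one map $T$:
  the absolute value equation is $x = T(x,x)$, the iteration is $x^{(k+1)} = T(x^{(k+1)},x^{(k)})$.
  The row inequalities of $(\langle A\rangle - |B|) v = e > 0$ say that
  $d(T(y,x),T(y',x')) \le q \max(d(y,y'), d(x,x'))$ for some $q < 1$, and everything follows from
  Banach's fixed point theorem.
\<close>

section \<open>Implicit contractions\<close>

text \<open>Passing from \<open>dist\<close> to \<open>d\<close> and back costs the factor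
  \<open>K * L\<close> once, not at every step. So a high enough iterate of \<open>F\<close>
  contracts in \<open>dist\<close>, and Banach's theorem applies to that iterate.\<close>

lemma contraction_in_equivalent_metric:
  fixes F :: "'a::complete_space \<Rightarrow> 'a" and d :: "'a \<Rightarrow> 'a \<Rightarrow> real"
  assumes q: "0 \<le> q" "q < 1" and contr: "\<And>x y. d (F x) (F y) \<le> q * d x y"
    and K: "0 \<le> K" "\<And>x y. dist x y \<le> K * d x y" and L: "0 \<le> L" "\<And>x y. d x y \<le> L * dist x y"
  obtains p where "F p = p" "\<And>y. F y = y \<Longrightarrow> y = p" "\<And>x. (\<lambda>k. (F ^^ k) x) \<longlonglongrightarrow> p"
proof -
  have d_iter: "d ((F ^^ k) x) ((F ^^ k) y) \<le> q ^ k * d x y" for k x y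
  proof (induction k)
    case (Suc k)
    have "d ((F ^^ Suc k) x) ((F ^^ Suc k) y) \<le> q * d ((F ^^ k) x) ((F ^^ k) y)"
      using contr by simp
    also have "\<dots> \<le> q * (q ^ k * d x y)"
      using Suc q by (intro mult_left_mono)
    finally show ?case by (simp add: mult_ac)
  qed simp
  have dist_iter: "dist ((F ^^ k) x) ((F ^^ k) y) \<le> (K * L * q ^ k) * dist x y" for k x y
  proof -
    have "dist ((F ^^ k) x) ((F ^^ k) y) \<le> K * (q ^ k * (L * dist x y))"
      by (meson K L d_iter mult_left_mono order_trans q(1) zero_le_power)
    then show ?thesis by (simp add: mult_ac)
  qed
  have lim: "(\<lambda>k. K * L * q ^ k) \<longlonglongrightarrow> 0"
    using q by (auto intro!: tendsto_mult_right_zero LIMSEQ_power_zero)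
  then obtain m where m: "K * L * q ^ m < 1"
    by (metis (no_types, lifting) eventually_sequentially less_numeral_extra(1) order_refl order_tendstoD(2))
  have "\<exists>!p. (F ^^ m) p = p"
    using banach_fix_type[of "K * L * q ^ m" "F ^^ m"] m dist_iter K(1) L(1) q(1) by simp
  then obtain p where p: "(F ^^ m) p = p" "\<And>y. (F ^^ m) y = y \<Longrightarrow> y = p"
    by metis
  \<comment> \<open>\<open>F p\<close> is fixed by \<open>F ^^ m\<close> as well, so it equals
    \<open>p\<close> by uniqueness.\<close>
  have fix_p: "F p = p"
    by (metis funpow_swap1 p)
  have fix_iter: "(F ^^ k) y = y" if "F y = y" for k y
    using that by (induction k) simp_all
  show ?thesis
  proof
    show "F p = p" by fact
    show "y = p" if "F y = y" for y
      using that fix_iter p(2) by blast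
    show "(\<lambda>k. (F ^^ k) x) \<longlonglongrightarrow> p" for x
    proof (rule metric_tendsto_imp_tendsto)
      show "(\<lambda>k. (K * L * q ^ k) * dist x p) \<longlonglongrightarrow> 0"
        using lim by (rule tendsto_mult_left_zero)
      show "\<forall>\<^sub>F k in sequentially. dist ((F ^^ k) x) p \<le> dist ((K * L * q ^ k) * dist x p) 0"
        using dist_iter[of _ x p] fix_iter[OF fix_p] K(1) L(1) q(1) by (simp add: abs_mult)
    qed
  qed
qed

text \<open>For a fixed old iterate \<open>x\<close>, the map \<open>T\<close> contracts in its
  first argument, so one implicit step has exactly one solution \<open>G x\<close>. The implicit
  iteration becomes the explicit iteration of \<open>G\<close>, which contracts with the same
  \<open>q\<close>.\<close>

lemma implicit_contraction_iteration:
  fixes T :: "'a::complete_space \<Rightarrow> 'a \<Rightarrow> 'a" and d :: "'a \<Rightarrow> 'a \<Rightarrow> real"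
  assumes q: "0 \<le> q" "q < 1"
    and contr: "\<And>x y x' y'. d (T y x) (T y' x') \<le> q * max (d y y') (d x x')"
    and d0: "\<And>x. d x x = 0"
    and K: "0 \<le> K" "\<And>x y. dist x y \<le> K * d x y" and L: "0 \<le> L" "\<And>x y. d x y \<le> L * dist x y"
  shows "\<exists>p. T p p = p \<and> (\<forall>y. T y y = y \<longrightarrow> y = p)
    \<and> (\<forall>x0. (\<exists>!x. x 0 = x0 \<and> (\<forall>k. T (x (Suc k)) (x k) = x (Suc k)))
         \<and> (\<forall>x. x 0 = x0 \<and> (\<forall>k. T (x (Suc k)) (x k) = x (Suc k)) \<longrightarrow> x \<longlonglongrightarrow> p))"
proof -
  \<comment> \<open>A negative \<open>d x y\<close> would give \<open>K * d x y \<le> 0\<close>,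
    hence \<open>x = y\<close>, where \<open>d\<close> vanishes.\<close>
  have d_nonneg: "0 \<le> d x y" for x y
    by (smt (verit) K mult_nonneg_nonpos zero_le_dist q contr d0 mult_less_0_iff L dist_eq_0_iff)
  have "\<exists>y. T y x = y \<and> (\<forall>z. T z x = z \<longrightarrow> z = y)" for x
  proof -
    have "d (T y x) (T y' x) \<le> q * d y y'" for y y'
      using contr[of y x y' x] d_nonneg[of y y'] by (simp add: d0)
    from contraction_in_equivalent_metric[OF q this K L] show ?thesis by metis
  qed
  then obtain G where G: "\<And>x. T (G x) x = G x" "\<And>x z. T z x = z \<Longrightarrow> z = G x"
    by metis
  have "d (G x) (G x') \<le> q * d x x'" for x x'
  proof -
    have le: "d (G x) (G x') \<le> q * max (d (G x) (G x')) (d x x')"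
      using contr[of "G x" x "G x'" x'] by (simp add: G)
    show ?thesis
    proof (cases "d (G x) (G x') \<le> d x x'")
      \<comment> \<open>The maximum is now \<open>d (G x) (G x')\<close> itself, and
        \<open>q < 1\<close> forces it to be at most 0.\<close>
      case False
      then have "(1 - q) * d (G x) (G x') \<le> 0"
        using le by (simp add: max_def algebra_simps)
      then have "d (G x) (G x') \<le> 0"
        using q by (simp add: mult_le_0_iff)
      then show ?thesis
        using d_nonneg[of x x'] q(1) by (meson mult_nonneg_nonneg order_trans)
    qed (use le in \<open>simp add: max_def split: if_splits\<close>)
  qed
  from contraction_in_equivalent_metric[OF q this K L] obtain p
    where p: "G p = p" "\<And>y. G y = y \<Longrightarrow> y = p" "\<And>x. (\<lambda>k. (G ^^ k) x) \<longlonglongrightarrow> p"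
    by blast
  \<comment> \<open>The admissible sequences are exactly the orbits of \<open>G\<close>, which
    settles their existence and uniqueness together.\<close>
  have iteration_iff:
    "x 0 = x0 \<and> (\<forall>k. T (x (Suc k)) (x k) = x (Suc k)) \<longleftrightarrow> x = (\<lambda>k. (G ^^ k) x0)" for x x0
  proof
    assume x: "x 0 = x0 \<and> (\<forall>k. T (x (Suc k)) (x k) = x (Suc k))"
    have "x k = (G ^^ k) x0" for k
    proof (induction k)
      case (Suc k)
      have "x (Suc k) = G (x k)"
        using x G(2) by blast
      then show ?case using Suc by simp
    qed (use x in simp)
    then show "x = (\<lambda>k. (G ^^ k) x0)" by blast
  qed (simp add: G(1))
  have "T p p = p" "T y y = y \<Longrightarrow> y = p" for y
    using G p(1,2) by metis+
  then show ?thesis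
    using p(3) unfolding iteration_iff by blast
qed

section \<open>The weighted maximum metric\<close>

text \<open>A plain function rather than a new metric space structure: completeness is taken from
  the Euclidean \<open>dist\<close>, to which the two bounds below compare it.\<close>

definition weighted_max_dist :: "real^'n \<Rightarrow> real^'n \<Rightarrow> real^'n \<Rightarrow> real" where
  "weighted_max_dist v x y = (MAX i. \<bar>x $ i - y $ i\<bar> / v $ i)"

lemma weighted_max_dist_le_iff:
  assumes "\<And>i. v $ i > 0"
  shows "weighted_max_dist v x y \<le> t \<longleftrightarrow> (\<forall>i. \<bar>x $ i - y $ i\<bar> \<le> t * v $ i)"
  using assms by (simp add: weighted_max_dist_def pos_divide_le_eq)

lemma abs_diff_le_weighted_max_dist:
  assumes "\<And>i. v $ i > 0"
  shows "\<bar>x $ i - y $ i\<bar> \<le> weighted_max_dist v x y * v $ i"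
  using weighted_max_dist_le_iff[OF assms, of x y "weighted_max_dist v x y"] by simp

lemma weighted_max_dist_refl [simp]: "weighted_max_dist v x x = 0"
  by (simp add: weighted_max_dist_def)

text \<open>The sum of the weights is a crude constant, but any constant will do, since powers of
  \<open>q\<close> absorb it.\<close>

lemma dist_le_weighted_max_dist:
  assumes "\<And>i. v $ i > 0"
  shows "dist x y \<le> (\<Sum>i\<in>UNIV. v $ i) * weighted_max_dist v x y"
proof -
  have "dist x y \<le> (\<Sum>i\<in>UNIV. \<bar>x $ i - y $ i\<bar>)"
    using norm_le_l1_cart[of "x - y"] by (simp add: dist_norm)
  also have "\<dots> \<le> (\<Sum>i\<in>UNIV. v $ i * weighted_max_dist v x y)"
    using abs_diff_le_weighted_max_dist[OF assms] by (intro sum_mono) (simp add: mult.commute)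
  finally show ?thesis by (simp add: sum_distrib_right)
qed

lemma weighted_max_dist_le_dist:
  assumes "\<And>i. v $ i > 0"
  shows "weighted_max_dist v x y \<le> (\<Sum>i\<in>UNIV. 1 / v $ i) * dist x y"
  unfolding weighted_max_dist_le_iff[OF assms]
proof
  fix i
  have "\<bar>x $ i - y $ i\<bar> \<le> dist x y"
    using component_le_norm_cart[of "x - y" i] by (simp add: dist_norm)
  also have "\<dots> = (1 / v $ i) * dist x y * v $ i"
    using assms[of i] by simp
  also have "\<dots> \<le> (\<Sum>i\<in>UNIV. 1 / v $ i) * dist x y * v $ i"
    using assms by (intro mult_right_mono member_le_sum) (auto simp: less_imp_le)
  finally show "\<bar>x $ i - y $ i\<bar> \<le> (\<Sum>i\<in>UNIV. 1 / v $ i) * dist x y * v $ i" .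
qed

section \<open>The scalar absolute value equation\<close>

text \<open>Both \<open>\<alpha> - \<beta>\<close> and \<open>\<alpha> + \<beta>\<close> will be
  positive, so the solution has the sign of \<open>c\<close>, and this sign decides which linear
  equation holds.\<close>

definition scalar_gave_solution :: "real \<Rightarrow> real \<Rightarrow> real \<Rightarrow> real" where
  "scalar_gave_solution \<alpha> \<beta> c = (if c \<ge> 0 then c / (\<alpha> - \<beta>) else c / (\<alpha> + \<beta>))"

text \<open>The linear term changes by exactly \<open>\<alpha> * \<bar>s - t\<bar>\<close>, the
  other by at most \<open>\<bar>\<beta>\<bar> * \<bar>s - t\<bar>\<close>. This expansion yields
  both uniqueness and the Lipschitz bound for the solution.\<close>

lemma scalar_gave_diff_bound:
  fixes \<alpha> \<beta> s t :: real
  assumes "\<alpha> > \<bar>\<beta>\<bar>"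
  shows "(\<alpha> - \<bar>\<beta>\<bar>) * \<bar>s - t\<bar> \<le> \<bar>(\<alpha> * s - \<beta> * \<bar>s\<bar>) - (\<alpha> * t - \<beta> * \<bar>t\<bar>)\<bar>"
proof -
  have "\<bar>\<beta> * (\<bar>s\<bar> - \<bar>t\<bar>)\<bar> \<le> \<bar>\<beta>\<bar> * \<bar>s - t\<bar>"
    unfolding abs_mult by (intro mult_left_mono) auto
  moreover have "\<bar>\<alpha> * (s - t)\<bar> = \<alpha> * \<bar>s - t\<bar>"
    using assms by (simp add: abs_mult)
  ultimately show ?thesis
    unfolding left_diff_distrib right_diff_distrib by linarith
qed

lemma scalar_gave_solution_works:
  assumes "\<alpha> > \<bar>\<beta>\<bar>"
  shows "\<alpha> * scalar_gave_solution \<alpha> \<beta> c - \<beta> * \<bar>scalar_gave_solution \<alpha> \<beta> c\<bar> = c"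
proof (cases "c \<ge> 0")
  case True
  have "\<alpha> - \<beta> > 0" using assms by linarith
  then show ?thesis
    using True by (simp add: scalar_gave_solution_def diff_divide_distrib[symmetric] left_diff_distrib[symmetric])
next
  case False
  have "\<alpha> + \<beta> > 0" using assms by linarith
  then show ?thesis
    using False by (simp add: scalar_gave_solution_def abs_div_pos[symmetric]
        add_divide_distrib[symmetric] distrib_right[symmetric])
qed

lemma scalar_gave_solution_iff:
  assumes "\<alpha> > \<bar>\<beta>\<bar>"
  shows "\<alpha> * t - \<beta> * \<bar>t\<bar> = c \<longleftrightarrow> scalar_gave_solution \<alpha> \<beta> c = t"
  using scalar_gave_diff_bound[OF assms, of t "scalar_gave_solution \<alpha> \<beta> c"]
    scalar_gave_solution_works[OF assms, of c] assms
  by (auto simp: mult_le_0_iff)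

lemma scalar_gave_solution_lipschitz:
  assumes "\<alpha> > \<bar>\<beta>\<bar>"
  shows "(\<alpha> - \<bar>\<beta>\<bar>) * \<bar>scalar_gave_solution \<alpha> \<beta> c - scalar_gave_solution \<alpha> \<beta> c'\<bar> \<le> \<bar>c - c'\<bar>"
  using scalar_gave_diff_bound[OF assms] by (metis scalar_gave_solution_works[OF assms])

section \<open>The Gauss--Seidel map\<close>

lemma abs_vec_nth [simp]: "\<bar>x :: real^'n\<bar> $ i = \<bar>x $ i\<bar>"
  by (simp add: abs_vec_def)

lemma diag_part_mult_nth: "(diag_part A *v x) $ i = A $ i $ i * x $ i"
  by (simp add: diag_part_def matrix_vector_mult_def if_distrib if_distribR sum.delta' cong: if_cong)

definition gs_rhs where
  "gs_rhs A B b y x = neg_strict_lower A *v y - neg_strict_lower B *v \<bar>y\<bar>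
     + neg_strict_upper A *v x - neg_strict_upper B *v \<bar>x\<bar> + b"

text \<open>No sweep is performed: the lower part acts on the given \<open>y\<close>, not on the
  rows just computed. A Gauss-Seidel step from \<open>x\<close> is a fixed point in
  \<open>y\<close>.\<close>

definition gs_map where
  "gs_map A B b y x = (\<chi> i. scalar_gave_solution (A $ i $ i) (B $ i $ i) (gs_rhs A B b y x $ i))"

lemma gs_map_fixpoint_iff:
  assumes "\<And>i. A $ i $ i > \<bar>B $ i $ i\<bar>"
  shows "gs_map A B b y x = y \<longleftrightarrow>
    (diag_part A - neg_strict_lower A) *v y - (diag_part B - neg_strict_lower B) *v \<bar>y\<bar>
      = neg_strict_upper A *v x - neg_strict_upper B *v \<bar>x\<bar> + b"
proof -
  have "gs_map A B b y x = y \<longleftrightarrow> diag_part A *v y - diag_part B *v \<bar>y\<bar> = gs_rhs A B b y x"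
    by (simp add: vec_eq_iff gs_map_def diag_part_mult_nth scalar_gave_solution_iff[OF assms])
  then show ?thesis
    by (auto simp: gs_rhs_def matrix_vector_mult_diff_rdistrib algebra_simps)
qed

text \<open>With equal arguments, the triangular parts recombine to the full matrices.\<close>

lemma gs_map_diagonal_fixpoint_iff:
  assumes "\<And>i. A $ i $ i > \<bar>B $ i $ i\<bar>"
  shows "gs_map A B b x x = x \<longleftrightarrow> gave_solution A B b x"
proof -
  have split_mult: "C *v z = (diag_part C - neg_strict_lower C) *v z - neg_strict_upper C *v z"
    for C :: "real^'a::{finite,linorder}^'a::{finite,linorder}" and z
    by (subst splitting) (simp add: matrix_vector_mult_diff_rdistrib)
  show ?thesis
    unfolding gs_map_fixpoint_iff[OF assms] gave_solution_def split_mult[of A] split_mult[of B]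
    by (auto simp: algebra_simps)
qed

text \<open>Row \<open>i\<close> sees \<open>y\<close> in columns before \<open>i\<close> and
  \<open>x\<close> in columns after it, hence a single mixed vector; a common bound \<open>w\<close>
  then allows one triangle inequality.\<close>

lemma gs_rhs_diff_bound:
  assumes y: "\<And>j. \<bar>y $ j - y' $ j\<bar> \<le> w $ j" and x: "\<And>j. \<bar>x $ j - x' $ j\<bar> \<le> w $ j"
  shows "\<bar>gs_rhs A B b y x $ i - gs_rhs A B b y' x' $ i\<bar>
    \<le> (\<Sum>j\<in>UNIV - {i}. (\<bar>A $ i $ j\<bar> + \<bar>B $ i $ j\<bar>) * w $ j)"
proof -
  let ?z = "\<lambda>j. if j < i then y $ j else x $ j" and ?z' = "\<lambda>j. if j < i then y' $ j else x' $ j"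
  have rhs: "gs_rhs A B b y x $ i
      = (\<Sum>j\<in>UNIV - {i}. B $ i $ j * \<bar>if j < i then y $ j else x $ j\<bar>
          - A $ i $ j * (if j < i then y $ j else x $ j)) + b $ i" for y x
  proof -
    have "gs_rhs A B b y x $ i = (\<Sum>j\<in>UNIV.
        (if j < i then - (A $ i $ j) else 0) * y $ j
        - (if j < i then - (B $ i $ j) else 0) * \<bar>y $ j\<bar>
        + (if i < j then - (A $ i $ j) else 0) * x $ j
        - (if i < j then - (B $ i $ j) else 0) * \<bar>x $ j\<bar>) + b $ i"
      by (simp add: gs_rhs_def matrix_vector_mult_def neg_strict_lower_def neg_strict_upper_def
          sum.distrib sum_subtractf)
    \<comment> \<open>The summand at \<open>j = i\<close> vanishes because both triangles are
      strict.\<close>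
    also have "\<dots> = (\<Sum>j\<in>UNIV - {i}. B $ i $ j * \<bar>if j < i then y $ j else x $ j\<bar>
          - A $ i $ j * (if j < i then y $ j else x $ j)) + b $ i"
      by (intro arg_cong[where f = "\<lambda>s. s + b $ i"] sum.mono_neutral_cong_right) auto
    finally show ?thesis .
  qed
  have "\<bar>gs_rhs A B b y x $ i - gs_rhs A B b y' x' $ i\<bar> \<le> (\<Sum>j\<in>UNIV - {i}.
      \<bar>(B $ i $ j * \<bar>?z j\<bar> - A $ i $ j * ?z j) - (B $ i $ j * \<bar>?z' j\<bar> - A $ i $ j * ?z' j)\<bar>)"
    unfolding rhs add_diff_cancel_right sum_subtractf[symmetric] by (rule sum_abs)
  also have "\<dots> \<le> (\<Sum>j\<in>UNIV - {i}. (\<bar>A $ i $ j\<bar> + \<bar>B $ i $ j\<bar>) * w $ j)"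
  proof (rule sum_mono)
    fix j
    have z: "\<bar>?z j - ?z' j\<bar> \<le> w $ j"
      using x y by simp
    then have "\<bar>A $ i $ j * (?z j - ?z' j)\<bar> \<le> \<bar>A $ i $ j\<bar> * w $ j"
      unfolding abs_mult by (intro mult_left_mono) auto
    moreover have "\<bar>B $ i $ j * (\<bar>?z j\<bar> - \<bar>?z' j\<bar>)\<bar> \<le> \<bar>B $ i $ j\<bar> * w $ j"
      unfolding abs_mult using z by (intro mult_left_mono) linarith+
    ultimately show "\<bar>(B $ i $ j * \<bar>?z j\<bar> - A $ i $ j * ?z j) - (B $ i $ j * \<bar>?z' j\<bar> - A $ i $ j * ?z' j)\<bar>
        \<le> (\<bar>A $ i $ j\<bar> + \<bar>B $ i $ j\<bar>) * w $ j"
      unfolding right_diff_distrib distrib_right by linarith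
  qed
  finally show ?thesis .
qed

lemma gs_map_contraction:
  assumes diag: "\<And>i. A $ i $ i > \<bar>B $ i $ i\<bar>" and v: "\<And>i. v $ i > 0"
    and dom: "\<And>i. (\<Sum>j\<in>UNIV - {i}. (\<bar>A $ i $ j\<bar> + \<bar>B $ i $ j\<bar>) * v $ j)
      \<le> q * ((A $ i $ i - \<bar>B $ i $ i\<bar>) * v $ i)"
  shows "weighted_max_dist v (gs_map A B b y x) (gs_map A B b y' x')
    \<le> q * max (weighted_max_dist v y y') (weighted_max_dist v x x')"
  unfolding weighted_max_dist_le_iff[OF v]
proof
  fix i
  \<comment> \<open>One radius for both arguments, so that \<open>t *\<^sub>R v\<close> can serve as
    the common bound and the dominance hypothesis applies to the whole row.\<close>
  define t where "t = max (weighted_max_dist v y y') (weighted_max_dist v x x')"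
  have t_nonneg: "0 \<le> t"
    using abs_diff_le_weighted_max_dist[OF v, of y i y'] v[of i]
    by (smt (verit) t_def max.cobounded1 mult_neg_pos)
  have y: "\<bar>y $ j - y' $ j\<bar> \<le> (t *\<^sub>R v) $ j" for j
    using weighted_max_dist_le_iff[OF v, of y y' t] by (simp add: t_def)
  have x: "\<bar>x $ j - x' $ j\<bar> \<le> (t *\<^sub>R v) $ j" for j
    using weighted_max_dist_le_iff[OF v, of x x' t] by (simp add: t_def)
  have "(A $ i $ i - \<bar>B $ i $ i\<bar>) * \<bar>gs_map A B b y x $ i - gs_map A B b y' x' $ i\<bar>
      \<le> \<bar>gs_rhs A B b y x $ i - gs_rhs A B b y' x' $ i\<bar>"
    by (simp add: gs_map_def scalar_gave_solution_lipschitz[OF diag])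
  also have "\<dots> \<le> t * (\<Sum>j\<in>UNIV - {i}. (\<bar>A $ i $ j\<bar> + \<bar>B $ i $ j\<bar>) * v $ j)"
    using gs_rhs_diff_bound[OF y x, of A B b i] by (simp add: sum_distrib_left mult_ac)
  also have "\<dots> \<le> t * (q * ((A $ i $ i - \<bar>B $ i $ i\<bar>) * v $ i))"
    using dom t_nonneg by (rule mult_left_mono)
  also have "\<dots> = (A $ i $ i - \<bar>B $ i $ i\<bar>) * (q * t * v $ i)"
    by (simp add: mult_ac)
  finally show "\<bar>gs_map A B b y x $ i - gs_map A B b y' x' $ i\<bar> \<le>
      q * max (weighted_max_dist v y y') (weighted_max_dist v x x') * v $ i"
    using diag[of i] by (simp add: t_def)
qed

section \<open>The weights\<close>

text \<open>Here \<open>1\<close> is the all-ones vector, so \<open>v\<close> consists of the row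
  sums of the nonnegative inverse.\<close>

lemma M_matrix_solves_one:
  assumes "M_matrix C"
  obtains v where "\<And>i. v $ i \<ge> 0" "C *v v = 1"
proof
  have inv: "C ** matrix_inv C = mat 1"
    using assms unfolding M_matrix_def invertible_def matrix_inv_def by (metis (mono_tags, lifting) someI_ex)
  show "C *v (matrix_inv C *v 1) = 1"
    using inv by (simp add: matrix_vector_mul_assoc)
  show "(matrix_inv C *v 1) $ i \<ge> 0" for i
    using assms by (auto simp: M_matrix_def matrix_vector_mult_def less_eq_vec_def intro!: sum_nonneg)
qed

text \<open>Row \<open>i\<close> of the system with right-hand side \<open>1\<close> says that the
  weighted off-diagonal sum is the weighted diagonal term minus 1. This is strict dominance, and
  having finitely many rows makes it uniform.\<close>

lemma dominance_weights:
  assumes diag: "\<And>i. A $ i $ i > \<bar>B $ i $ i\<bar>" and M: "M_matrix (comparison_matrix A - \<bar>B\<bar>)"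
  obtains v q where "\<And>i. v $ i > 0" "0 \<le> q" "q < 1"
    "\<And>i. (\<Sum>j\<in>UNIV - {i}. (\<bar>A $ i $ j\<bar> + \<bar>B $ i $ j\<bar>) * v $ j)
      \<le> q * ((A $ i $ i - \<bar>B $ i $ i\<bar>) * v $ i)"
proof -
  obtain v where v0: "\<And>i. v $ i \<ge> 0" and v1: "(comparison_matrix A - \<bar>B\<bar>) *v v = 1"
    using M_matrix_solves_one[OF M] by blast
  define m where "m i = (A $ i $ i - \<bar>B $ i $ i\<bar>) * v $ i" for i
  define s where "s i = (\<Sum>j\<in>UNIV - {i}. (\<bar>A $ i $ j\<bar> + \<bar>B $ i $ j\<bar>) * v $ j)" for i
  have row: "s i = m i - 1" for i
  proof -
    have "1 = (\<Sum>j\<in>UNIV. (comparison_matrix A - \<bar>B\<bar>) $ i $ j * v $ j)"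
      using v1 by (simp add: vec_eq_iff matrix_vector_mult_def)
    also have "\<dots> = m i + (\<Sum>j\<in>UNIV - {i}. (comparison_matrix A - \<bar>B\<bar>) $ i $ j * v $ j)"
      using diag[of i] by (subst sum.remove[of _ i]) (auto simp: m_def comparison_matrix_def abs_vec_def)
    also have "(\<Sum>j\<in>UNIV - {i}. (comparison_matrix A - \<bar>B\<bar>) $ i $ j * v $ j) = - s i"
      unfolding s_def sum_negf[symmetric]
      by (intro sum.cong) (auto simp: comparison_matrix_def abs_vec_def algebra_simps)
    finally show ?thesis by simp
  qed
  have s0: "s i \<ge> 0" for i
    unfolding s_def using v0 by (intro sum_nonneg) simp
  have m1: "m i \<ge> 1" for i
    using s0[of i] row[of i] by simp
  \<comment> \<open>A zero weight would make \<open>m i\<close> zero, against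
    \<open>m i \<ge> 1\<close>.\<close>
  have v_pos: "v $ i > 0" for i
    using m1[of i] v0[of i] by (cases "v $ i = 0") (auto simp: m_def)
  define q where "q = (MAX i. s i / m i)"
  have q_ge: "s i / m i \<le> q" for i
    by (simp add: q_def)
  show ?thesis
  proof
    show "v $ i > 0" for i by fact
    \<comment> \<open>\<open>undefined\<close> merely names some index; a single nonnegative ratio
      suffices.\<close>
    show "0 \<le> q"
      using q_ge[of undefined] s0[of undefined] m1[of undefined]
      by (smt (verit) divide_nonneg_nonneg)
    have "s i / m i < 1" for i
      using row[of i] m1[of i] by (simp add: divide_less_eq)
    then show "q < 1"
      by (simp add: q_def)
    show "(\<Sum>j\<in>UNIV - {i}. (\<bar>A $ i $ j\<bar> + \<bar>B $ i $ j\<bar>) * v $ j)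
        \<le> q * ((A $ i $ i - \<bar>B $ i $ i\<bar>) * v $ i)" for i
      using q_ge[of i] m1[of i] by (simp add: s_def[symmetric] m_def[symmetric] divide_le_eq)
  qed
qed

theorem theorem3p2:
  fixes A B :: "real^'n::{finite,linorder}^'n::{finite,linorder}" and b :: "real^'n::{finite,linorder}"
  assumes "\<And>i. A $ i $ i > \<bar>B $ i $ i\<bar>"
    and "M_matrix (comparison_matrix A - \<bar>B\<bar>)"
  shows "\<exists>xs. gave_solution A B b xs
           \<and> (\<forall>y. gave_solution A B b y \<longrightarrow> y = xs)
           \<and> (\<forall>x0. (\<exists>!x. x 0 = x0 \<and> gave_iteration A B b x)
                  \<and> (\<forall>x. x 0 = x0 \<and> gave_iteration A B b x \<longrightarrow> x \<longlonglongrightarrow> xs))"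
proof -
  obtain v q where v: "\<And>i. v $ i > 0" and q: "0 \<le> q" "q < 1"
    and dom: "\<And>i. (\<Sum>j\<in>UNIV - {i}. (\<bar>A $ i $ j\<bar> + \<bar>B $ i $ j\<bar>) * v $ j)
      \<le> q * ((A $ i $ i - \<bar>B $ i $ i\<bar>) * v $ i)"
    using dominance_weights[OF assms] by blast
  have iteration: "gave_iteration A B b x \<longleftrightarrow> (\<forall>k. gs_map A B b (x (Suc k)) (x k) = x (Suc k))" for x
    unfolding gave_iteration_def gs_map_fixpoint_iff[OF assms(1)] ..
  have "0 \<le> (\<Sum>i\<in>UNIV. v $ i)" "0 \<le> (\<Sum>i\<in>UNIV. 1 / v $ i)"
    using v by (auto intro!: sum_nonneg simp: less_imp_le)
  \<comment> \<open>The constants \<open>K\<close> and \<open>L\<close> are the sums of the weights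
    and of their reciprocals.\<close>
  from implicit_contraction_iteration[OF q gs_map_contraction[OF assms(1) v dom] weighted_max_dist_refl
      this(1) dist_le_weighted_max_dist[OF v] this(2) weighted_max_dist_le_dist[OF v], of b]
  show ?thesis
    unfolding iteration gs_map_diagonal_fixpoint_iff[OF assms(1)] .
qed

end
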